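(* Let $(X,\delta)$ be a finite submodular diversity. Then $(X,\delta)$ is sublinear-embeddable.
   Context: A diversity is a pair $(X,\delta)$ where $X$ is a set and $\delta$ is a real-valued function on finite subsets of $X$ satisfying (D1') $\delta(A)=0$ if $|A|\le 1$, and (D2) $\delta(A\cup C)\le \delta(A\cup B)+\delta(B\cup C)$ for all finite $A,B,C\subseteq X$ with $B\neq\emptyset$. (So $\delta$ may vanish on sets with two or more elements.) Given (D1'), axiom (D2) is equivalent to: $\delta$ is non-decreasing ($A\subseteq B$ implies $\delta(A)\le\delta(B)$) and $\delta(A\cup B)\le\delta(A)+\delta(B)$ whenever $A\cap B\ne\emptyset$. The diversity is finite if $X$ is finite. A diversity $(X,\delta)$ is submodular if $\delta(A\cup B)+\delta(A\cap B)\le\delta(A)+\delta(B)$ for all $A,B$ with $A\cap B\neq\emptyset$. A diversity $(\mathbb{R}^k,\delta)$ is sublinear if $\delta(\lambda A)=\lambda\delta(A)$ and $\delta(A+B)\le\delta(A)+\delta(B)$ for all $\lambda\ge 0$ and all nonempty finite $A,B\subseteq\mathbb{R}^k$, where $\lambda A=\{\lambda a:a\in A\}$ and $A+B=\{a+b:a\in A,\,b\in B\}$. An (isometric) embedding of a diversity $(X,\delta_X)$ into a diversity $(Y,\delta_Y)$ is a map $\phi:X\to Y$ (not required to be injective) such that $\delta_Y(\phi(A))=\delta_X(A)$ for all finite $A\subseteq X$. A diversity is sublinear-embeddable if it has an isometric embedding into a sublinear diversity on $\mathbb{R}^k$ for some $k$. *)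

theory Defs
  imports "Jordan_Normal_Form.Matrix" "HOL-Library.Set_Algebras"
begin

text \<open>
  A diversity on \<open>X\<close> is a real-valued function on the finite subsets of \<open>X\<close>. It is modelled by
  a total function on sets; its values on other sets are unconstrained and never used.
\<close>

locale diversity =
  fixes X :: "'a set" and \<delta> :: "'a set \<Rightarrow> real"
  assumes trivial: "\<lbrakk>finite A; A \<subseteq> X; card A \<le> 1\<rbrakk> \<Longrightarrow> \<delta> A = 0"
    and triangle: "\<lbrakk>finite A; finite B; finite C; A \<subseteq> X; B \<subseteq> X; C \<subseteq> X; B \<noteq> {}\<rbrakk>
      \<Longrightarrow> \<delta> (A \<union> C) \<le> \<delta> (A \<union> B) + \<delta> (B \<union> C)"

locale submodular_diversity = diversity +
  assumes submodular: "\<lbrakk>finite A; finite B; A \<subseteq> X; B \<subseteq> X; A \<inter> B \<noteq> {}\<rbrakk>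
      \<Longrightarrow> \<delta> (A \<union> B) + \<delta> (A \<inter> B) \<le> \<delta> A + \<delta> B"

text \<open>
  The dimension \<open>k\<close> is existentially quantified in the notion of embeddability below, so
  k-dimensional real space is the carrier \<open>carrier_vec k\<close> of real vectors of dimension \<open>k\<close>
  rather than a type indexed by its dimension. \<open>A + B\<close> is the Minkowski sum of sets.
\<close>

locale sublinear_diversity = diversity "carrier_vec k :: real vec set" \<delta>
  for k :: nat and \<delta> :: "real vec set \<Rightarrow> real" +
  assumes homogeneous: "\<lbrakk>0 \<le> c; finite A; A \<noteq> {}; A \<subseteq> carrier_vec k\<rbrakk>
      \<Longrightarrow> \<delta> ((\<lambda>a. c \<cdot>\<^sub>v a) ` A) = c * \<delta> A"
    and subadditive: "\<lbrakk>finite A; finite B; A \<noteq> {}; B \<noteq> {}; A \<subseteq> carrier_vec k; B \<subseteq> carrier_vec k\<rbrakk>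
      \<Longrightarrow> \<delta> (A + B) \<le> \<delta> A + \<delta> B"

definition diversity_embedding ::
    "('a \<Rightarrow> 'b) \<Rightarrow> 'a set \<Rightarrow> ('a set \<Rightarrow> real) \<Rightarrow> 'b set \<Rightarrow> ('b set \<Rightarrow> real) \<Rightarrow> bool" where
  "diversity_embedding \<phi> X \<delta>X Y \<delta>Y \<longleftrightarrow>
     \<phi> ` X \<subseteq> Y \<and> (\<forall>A. finite A \<and> A \<subseteq> X \<longrightarrow> \<delta>Y (\<phi> ` A) = \<delta>X A)"

definition sublinear_embeddable :: "'a set \<Rightarrow> ('a set \<Rightarrow> real) \<Rightarrow> bool" where
  "sublinear_embeddable X \<delta> \<longleftrightarrow>
     (\<exists>k \<delta>' \<phi>. sublinear_diversity k \<delta>' \<and> diversity_embedding \<phi> X \<delta> (carrier_vec k) \<delta>')"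

end

theory Submission
  imports Defs
begin

text \<open>
  The diversity is written as a finite maximum of explicit pieces, one for each \<open>B \<subseteq> X\<close>, each lying
  below \<open>\<delta>\<close> and touching it at \<open>B\<close>; each piece is visibly the restriction of a sublinear diversity.

  A source of sublinear diversities: if linear functionals \<open>u\<^sub>i\<close> sum to zero, then
  \<open>V \<mapsto> \<Sum>\<^sub>i max\<^bsub>v\<in>V\<^esub> u\<^sub>i(v)\<close> is one, because each summand is the value at \<open>u\<^sub>i\<close> of the support
  function of the convex hull of \<open>V\<close> and the zero sum makes singletons
  vanish (\<open>sublinear_diversity_sum_of_maxima\<close>). Finite maxima of sublinear diversities are sublinear again (\<open>sublinear_diversity_Max\<close>). With the points
  of \<open>X\<close> sent to distinct unit vectors, every real function on \<open>X\<close> is the trace of a linear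
  functional. So it suffices to find, for each nonempty \<open>B\<close>, functions \<open>a\<^sub>i\<close> on \<open>X\<close> with \<open>\<Sum>\<^sub>i a\<^sub>i = 0\<close> and
  \<open>\<Sum>\<^sub>i max\<^bsub>x\<in>A\<^esub> a\<^sub>i(x) \<le> \<delta>(A)\<close> for all nonempty \<open>A\<close>, with equality at \<open>A = B\<close>.

  The idea is taken from the case where \<open>\<delta>\<close> is replaced by the rank function of a matroid. Along a
  chain \<open>P\<^sub>0 \<subseteq> P\<^sub>1 \<subseteq> \<dots>\<close> of sets whose ranks grow one at a time, each element enters the span at one
  level; the number of levels at which some element of \<open>A\<close> enters is at most the rank of \<open>A\<close>, with
  equality for the members of the chain. For a general submodular \<open>\<delta>\<close> the element \<open>x\<close> enters
  gradually: at level \<open>i\<close> it does so by the amount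
  \<open>a\<^sub>i(x) = (\<delta>(P\<^sub>i \<union> {x}) - \<delta>(P\<^sub>i)) - (\<delta>(P\<^bsub>i+1\<^esub> \<union> {x}) - \<delta>(P\<^bsub>i+1\<^esub>))\<close>
  by which its marginal value drops when \<open>P\<^sub>i\<close> grows to \<open>P\<^bsub>i+1\<^esub>\<close>. The same amount \<open>a\<^sub>i(A)\<close> makes sense
  for a set \<open>A\<close>; it telescopes over the levels to \<open>\<delta>(A) - \<delta>(\<emptyset>) = \<delta>(A)\<close> (\<open>sum_profile\<close>), which for
  singletons is the zero sum. Submodularity gives \<open>a\<^sub>i(x) \<le> a\<^sub>i(A)\<close> for \<open>x \<in> A\<close>
  (\<open>gain_drop_mono\<close>), hence the upper bound. For equality at \<open>B\<close>, the chain is obtained by listing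
  \<open>X\<close> with the elements of \<open>B\<close> first (\<open>sum_Max_profile_prefix_ge\<close>).
\<close>

section \<open>Sublinear diversities from zero-sum families of linear functionals\<close>

definition sum_of_maxima :: "'i set \<Rightarrow> ('i \<Rightarrow> real vec) \<Rightarrow> real vec set \<Rightarrow> real" where
  "sum_of_maxima I u V = (if V = {} then 0 else \<Sum>i\<in>I. Max ((\<lambda>v. u i \<bullet> v) ` V))"

text \<open>
  For the triangle inequality, let \<open>b \<in> B\<close>: a maximum over \<open>A \<union> C\<close> is attained in \<open>A \<union> B\<close> or in
  \<open>B \<union> C\<close>, and the maximum over the other of these two sets is at least the value at \<open>b\<close>. The
  values at \<open>b\<close> add up to zero over the functionals.
\<close>

lemma sublinear_diversity_sum_of_maxima:
  fixes u :: "'i \<Rightarrow> real vec"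
  assumes u: "\<And>i. i \<in> I \<Longrightarrow> u i \<in> carrier_vec k"
    and zero_sum: "\<And>v. v \<in> carrier_vec k \<Longrightarrow> (\<Sum>i\<in>I. u i \<bullet> v) = 0"
  shows "sublinear_diversity k (sum_of_maxima I u)"
proof
  fix A :: "real vec set"
  assume A: "finite A" "A \<subseteq> carrier_vec k" "card A \<le> 1"
  show "sum_of_maxima I u A = 0"
  proof (cases "A = {}")
    case False
    then obtain a where "A = {a}"
      using A by (metis card_0_eq card_1_singletonE le_neq_implies_less less_one)
    then show ?thesis
      using A zero_sum by (simp add: sum_of_maxima_def)
  qed (simp add: sum_of_maxima_def)
next
  have upper: "u i \<bullet> v \<le> Max ((\<lambda>v. u i \<bullet> v) ` V)" if "finite V" "v \<in> V" for i v V
    using that by (intro Max_ge) auto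
  fix A B C :: "real vec set"
  assume fin: "finite A" "finite B" "finite C"
    and car: "A \<subseteq> carrier_vec k" "B \<subseteq> carrier_vec k" "C \<subseteq> carrier_vec k" and "B \<noteq> {}"
  from \<open>B \<noteq> {}\<close> obtain b where b: "b \<in> B" by blast
  show "sum_of_maxima I u (A \<union> C) \<le> sum_of_maxima I u (A \<union> B) + sum_of_maxima I u (B \<union> C)"
  proof (cases "A \<union> C = {}")
    case True
    have "0 = (\<Sum>i\<in>I. u i \<bullet> b)"
      using zero_sum b car by auto
    also have "\<dots> \<le> (\<Sum>i\<in>I. Max ((\<lambda>v. u i \<bullet> v) ` B))"
      using b fin by (intro sum_mono upper)
    finally show ?thesis
      using True b by (auto simp: sum_of_maxima_def)
  next
    case False
    have "(\<Sum>i\<in>I. Max ((\<lambda>v. u i \<bullet> v) ` (A \<union> C)))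
      \<le> (\<Sum>i\<in>I. Max ((\<lambda>v. u i \<bullet> v) ` (A \<union> B)) + Max ((\<lambda>v. u i \<bullet> v) ` (B \<union> C)) - u i \<bullet> b)"
    proof (rule sum_mono)
      fix i
      show "Max ((\<lambda>v. u i \<bullet> v) ` (A \<union> C))
        \<le> Max ((\<lambda>v. u i \<bullet> v) ` (A \<union> B)) + Max ((\<lambda>v. u i \<bullet> v) ` (B \<union> C)) - u i \<bullet> b"
      proof (rule Max.boundedI)
        fix y assume "y \<in> (\<lambda>v. u i \<bullet> v) ` (A \<union> C)"
        then obtain v where v: "v \<in> A \<union> C" "y = u i \<bullet> v" by blast
        have "u i \<bullet> b \<le> Max ((\<lambda>v. u i \<bullet> v) ` (A \<union> B))" "u i \<bullet> b \<le> Max ((\<lambda>v. u i \<bullet> v) ` (B \<union> C))"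
          using b fin by (auto intro!: upper)
        moreover have "y \<le> Max ((\<lambda>v. u i \<bullet> v) ` (A \<union> B)) \<or> y \<le> Max ((\<lambda>v. u i \<bullet> v) ` (B \<union> C))"
          using v upper[of "A \<union> B" v i] upper[of "B \<union> C" v i] fin by auto
        ultimately show "y \<le> Max ((\<lambda>v. u i \<bullet> v) ` (A \<union> B)) + Max ((\<lambda>v. u i \<bullet> v) ` (B \<union> C)) - u i \<bullet> b"
          by linarith
      qed (use fin False in auto)
    qed
    also have "\<dots> = (\<Sum>i\<in>I. Max ((\<lambda>v. u i \<bullet> v) ` (A \<union> B))) + (\<Sum>i\<in>I. Max ((\<lambda>v. u i \<bullet> v) ` (B \<union> C)))
        - (\<Sum>i\<in>I. u i \<bullet> b)"
      by (simp add: sum.distrib sum_subtractf)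
    also have "(\<Sum>i\<in>I. u i \<bullet> b) = 0"
      using zero_sum b car by auto
    finally show ?thesis
      using False \<open>B \<noteq> {}\<close> by (auto simp: sum_of_maxima_def)
  qed
next
  fix c :: real and A :: "real vec set"
  assume A: "0 \<le> c" "finite A" "A \<noteq> {}" "A \<subseteq> carrier_vec k"
  have "Max ((\<lambda>v. u i \<bullet> v) ` (\<lambda>a. c \<cdot>\<^sub>v a) ` A) = c * Max ((\<lambda>v. u i \<bullet> v) ` A)" if "i \<in> I" for i
  proof -
    have "(\<lambda>v. u i \<bullet> v) ` (\<lambda>a. c \<cdot>\<^sub>v a) ` A = (\<lambda>t. c * t) ` (\<lambda>v. u i \<bullet> v) ` A"
      unfolding image_image
      by (rule image_cong) (use u[OF that] A in auto)
    moreover have "mono (\<lambda>t. c * t)"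
      using A by (simp add: mono_def mult_left_mono)
    ultimately show ?thesis
      using A by (simp add: mono_Max_commute)
  qed
  then show "sum_of_maxima I u ((\<lambda>a. c \<cdot>\<^sub>v a) ` A) = c * sum_of_maxima I u A"
    using A by (simp add: sum_of_maxima_def sum_distrib_left)
next
  fix A B :: "real vec set"
  assume fin: "finite A" "finite B" and ne: "A \<noteq> {}" "B \<noteq> {}"
    and car: "A \<subseteq> carrier_vec k" "B \<subseteq> carrier_vec k"
  have "Max ((\<lambda>v. u i \<bullet> v) ` (A + B)) \<le> Max ((\<lambda>v. u i \<bullet> v) ` A) + Max ((\<lambda>v. u i \<bullet> v) ` B)"
    if "i \<in> I" for i
  proof (rule Max.boundedI)
    fix y assume "y \<in> (\<lambda>v. u i \<bullet> v) ` (A + B)"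
    then obtain a b where ab: "a \<in> A" "b \<in> B" "y = u i \<bullet> (a + b)"
      by (auto simp: set_plus_def)
    then have "y = u i \<bullet> a + u i \<bullet> b"
      using scalar_prod_add_distrib u[OF that] car by blast
    also have "\<dots> \<le> Max ((\<lambda>v. u i \<bullet> v) ` A) + Max ((\<lambda>v. u i \<bullet> v) ` B)"
      using ab fin by (intro add_mono Max_ge) auto
    finally show "y \<le> Max ((\<lambda>v. u i \<bullet> v) ` A) + Max ((\<lambda>v. u i \<bullet> v) ` B)" .
  qed (use fin ne finite_set_plus[OF fin] in \<open>auto simp: set_plus_def\<close>)
  moreover have "A + B \<noteq> {}"
    using ne by (auto simp: set_plus_def)
  ultimately show "sum_of_maxima I u (A + B) \<le> sum_of_maxima I u A + sum_of_maxima I u B"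
    using ne by (simp add: sum_of_maxima_def sum_mono flip: sum.distrib)
qed

lemma sublinear_diversity_Max:
  assumes J: "finite J" "J \<noteq> {}"
    and D: "\<And>j. j \<in> J \<Longrightarrow> sublinear_diversity k (D j)"
  shows "sublinear_diversity k (\<lambda>V. Max ((\<lambda>j. D j V) ` J))"
proof
  fix A :: "real vec set"
  assume *: "finite A" "A \<subseteq> carrier_vec k" "card A \<le> 1"
  have "D j A = 0" if "j \<in> J" for j
    using diversity.trivial[OF sublinear_diversity.axioms(1)[OF D[OF that]] *] .
  then have "(\<lambda>j. D j A) ` J = {0}"
    using J by auto
  then show "Max ((\<lambda>j. D j A) ` J) = 0" by simp
next
  have upper: "D j V \<le> Max ((\<lambda>j. D j V) ` J)" if "j \<in> J" for j V
    using that J by (intro Max_ge) auto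
  fix A B C :: "real vec set"
  assume *: "finite A" "finite B" "finite C"
    "A \<subseteq> carrier_vec k" "B \<subseteq> carrier_vec k" "C \<subseteq> carrier_vec k" "B \<noteq> {}"
  have "D j (A \<union> C) \<le> Max ((\<lambda>j. D j (A \<union> B)) ` J) + Max ((\<lambda>j. D j (B \<union> C)) ` J)" if "j \<in> J" for j
    using diversity.triangle[OF sublinear_diversity.axioms(1)[OF D[OF that]] *]
      upper[OF that, of "A \<union> B"] upper[OF that, of "B \<union> C"] by linarith
  then show "Max ((\<lambda>j. D j (A \<union> C)) ` J)
      \<le> Max ((\<lambda>j. D j (A \<union> B)) ` J) + Max ((\<lambda>j. D j (B \<union> C)) ` J)"
    using J by (intro Max.boundedI) auto
next
  fix c :: real and A :: "real vec set"
  assume A: "0 \<le> c" "finite A" "A \<noteq> {}" "A \<subseteq> carrier_vec k"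
  have "(\<lambda>j. D j ((\<lambda>a. c \<cdot>\<^sub>v a) ` A)) ` J = (\<lambda>t. c * t) ` (\<lambda>j. D j A) ` J"
    unfolding image_image
    by (rule image_cong) (use sublinear_diversity.homogeneous[OF D A] in auto)
  moreover have "mono (\<lambda>t. c * t)"
    using A by (simp add: mono_def mult_left_mono)
  ultimately show "Max ((\<lambda>j. D j ((\<lambda>a. c \<cdot>\<^sub>v a) ` A)) ` J) = c * Max ((\<lambda>j. D j A) ` J)"
    using J by (simp add: mono_Max_commute)
next
  have upper: "D j V \<le> Max ((\<lambda>j. D j V) ` J)" if "j \<in> J" for j V
    using that J by (intro Max_ge) auto
  fix A B :: "real vec set"
  assume *: "finite A" "finite B" "A \<noteq> {}" "B \<noteq> {}" "A \<subseteq> carrier_vec k" "B \<subseteq> carrier_vec k"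
  have "D j (A + B) \<le> Max ((\<lambda>j. D j A) ` J) + Max ((\<lambda>j. D j B) ` J)" if "j \<in> J" for j
    using sublinear_diversity.subadditive[OF D[OF that] *]
      upper[OF that, of A] upper[OF that, of B] by linarith
  then show "Max ((\<lambda>j. D j (A + B)) ` J) \<le> Max ((\<lambda>j. D j A) ` J) + Max ((\<lambda>j. D j B) ` J)"
    using J by (intro Max.boundedI) auto
qed

section \<open>The profile of a point along an enumeration\<close>

lemma (in diversity) mono:
  assumes "finite B" "A \<subseteq> B" "B \<subseteq> X"
  shows "\<delta> A \<le> \<delta> B"
proof -
  have "\<delta> A \<le> \<delta> (A \<union> C)" if "finite C" "C \<subseteq> X" for C
    using that
  proof (induction C rule: finite_induct)
    case (insert c C)
    have "\<delta> ((A \<union> C) \<union> {}) \<le> \<delta> ((A \<union> C) \<union> {c}) + \<delta> ({c} \<union> {})"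
      using assms insert finite_subset by (intro triangle) auto
    moreover have "\<delta> {c} = 0"
      using insert.prems by (intro trivial) auto
    ultimately show ?case
      using insert by simp
  qed simp
  then show ?thesis
    using assms by (metis Un_absorb1)
qed

text \<open>
  With \<open>\<delta>(P \<union> A) - \<delta>(P)\<close> read as the marginal value of \<open>A\<close> over \<open>P\<close>, this is the loss of marginal
  value of \<open>A\<close> when \<open>P\<close> is enlarged to \<open>Q\<close>.
\<close>

definition gain_drop :: "('a set \<Rightarrow> real) \<Rightarrow> 'a set \<Rightarrow> 'a set \<Rightarrow> 'a set \<Rightarrow> real" where
  "gain_drop \<delta> P Q A = (\<delta> (P \<union> A) - \<delta> P) - (\<delta> (Q \<union> A) - \<delta> Q)"

definition profile :: "('a set \<Rightarrow> real) \<Rightarrow> 'a list \<Rightarrow> nat \<Rightarrow> 'a set \<Rightarrow> real" where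
  "profile \<delta> xs i A = gain_drop \<delta> (set (take i xs)) (set (take (Suc i) xs)) A"

lemma sum_profile:
  assumes "A \<subseteq> set xs"
  shows "(\<Sum>i<length xs. profile \<delta> xs i A) = \<delta> A - \<delta> {}"
proof -
  define g where "g i = \<delta> (set (take i xs) \<union> A) - \<delta> (set (take i xs))" for i
  have "(\<Sum>i<length xs. profile \<delta> xs i A) = (\<Sum>i<length xs. g i - g (Suc i))"
    by (simp add: profile_def gain_drop_def g_def)
  also have "\<dots> = g 0 - g (length xs)"
    by (rule sum_lessThan_telescope')
  also have "\<dots> = \<delta> A - \<delta> {}"
    using assms by (simp add: g_def Un_absorb2)
  finally show ?thesis .
qed

context submodular_diversity
begin

text \<open>
  Submodularity is applied to \<open>Q \<union> {x}\<close> and \<open>P \<union> A\<close>, which meet in \<open>x\<close>; so no common point of \<open>P\<close> and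
  \<open>Q\<close> is needed and the chain may start at \<open>P = {}\<close>. Their intersection can be larger than
  \<open>P \<union> {x}\<close>, which monotonicity absorbs.
\<close>

lemma gain_drop_mono:
  assumes "finite Q" "Q \<subseteq> X" "P \<subseteq> Q" "finite A" "A \<subseteq> X" "x \<in> A"
  shows "gain_drop \<delta> P Q {x} \<le> gain_drop \<delta> P Q A"
proof -
  have fin: "finite P"
    using assms finite_subset by blast
  have "\<delta> ((Q \<union> {x}) \<union> (P \<union> A)) + \<delta> ((Q \<union> {x}) \<inter> (P \<union> A)) \<le> \<delta> (Q \<union> {x}) + \<delta> (P \<union> A)"
    using assms fin by (intro submodular) auto
  moreover have "(Q \<union> {x}) \<union> (P \<union> A) = Q \<union> A"
    using assms by auto
  moreover have "\<delta> (P \<union> {x}) \<le> \<delta> ((Q \<union> {x}) \<inter> (P \<union> A))"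
    using assms fin by (intro mono) auto
  ultimately show ?thesis
    by (simp add: gain_drop_def)
qed

lemma sum_Max_profile_le:
  assumes xs: "set xs = X" and A: "A \<subseteq> X" "A \<noteq> {}"
  shows "(\<Sum>i<length xs. Max ((\<lambda>x. profile \<delta> xs i {x}) ` A)) \<le> \<delta> A"
proof -
  have fin: "finite A"
    using A xs finite_subset by blast
  have "(\<Sum>i<length xs. Max ((\<lambda>x. profile \<delta> xs i {x}) ` A)) \<le> (\<Sum>i<length xs. profile \<delta> xs i A)"
  proof (intro sum_mono Max.boundedI; clarsimp simp: fin A)
    fix i x assume "x \<in> A"
    then show "profile \<delta> xs i {x} \<le> profile \<delta> xs i A"
      unfolding profile_def using fin A xs set_take_subset[of "Suc i" xs]
      by (intro gain_drop_mono set_take_subset_set_take) auto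
  qed
  also have "\<dots> = \<delta> A"
    using A xs trivial[of "{}"] by (simp add: sum_profile)
  finally show ?thesis .
qed

text \<open>
  At each level below \<open>length ys\<close> the element being added already has profile equal to the increment
  of \<open>\<delta>\<close> along the prefixes of \<open>ys\<close>, since its marginal value over the next prefix is zero. At later
  levels all of \<open>ys\<close> lies in both prefixes and contributes nothing. The increments telescope.
\<close>

lemma sum_Max_profile_prefix_ge:
  assumes xs: "ys @ zs = xs" "set xs = X" and ne: "ys \<noteq> []"
  shows "\<delta> (set ys) \<le> (\<Sum>i<length xs. Max ((\<lambda>x. profile \<delta> xs i {x}) ` set ys))"
proof -
  \<comment> \<open>Prefixes of \<open>ys\<close>, not of \<open>xs\<close>: the chain is constant from index \<open>length ys\<close> on, so both kinds
    of level obey one formula.\<close>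
  define P where "P i = set (take i ys)" for i
  have level: "\<delta> (P (Suc i)) - \<delta> (P i) \<le> Max ((\<lambda>x. profile \<delta> xs i {x}) ` set ys)" for i
  proof -
    define x where "x = (if i < length ys then ys ! i else hd ys)"
    have x: "x \<in> set ys"
      using ne by (auto simp: x_def)
    have "profile \<delta> xs i {x} = \<delta> (P (Suc i)) - \<delta> (P i)"
    proof (cases "i < length ys")
      case True
      then have "set (take i xs) = P i" "set (take (Suc i) xs) = P (Suc i)"
        using xs by (auto simp: P_def)
      moreover have "P i \<union> {x} = P (Suc i)" "P (Suc i) \<union> {x} = P (Suc i)"
        using True by (auto simp: P_def x_def take_Suc_conv_app_nth)
      ultimately show ?thesis
        by (simp add: profile_def gain_drop_def)
    next
      case False
      then have "x \<in> set (take i xs)" "x \<in> set (take (Suc i) xs)" "P i = P (Suc i)"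
        using xs x by (auto simp: P_def)
      then show ?thesis
        by (simp add: profile_def gain_drop_def insert_absorb)
    qed
    then show ?thesis
      using x by (metis (no_types, lifting) Max_ge finite_imageI finite_set image_eqI)
  qed
  have "\<delta> (set ys) = (\<Sum>i<length xs. \<delta> (P (Suc i)) - \<delta> (P i))"
    using xs(1)[symmetric] trivial[of "{}"]
    by (simp only: sum_lessThan_telescope[of "\<lambda>i. \<delta> (P i)"]) (simp add: P_def)
  also have "\<dots> \<le> (\<Sum>i<length xs. Max ((\<lambda>x. profile \<delta> xs i {x}) ` set ys))"
    by (intro sum_mono level)
  finally show ?thesis .
qed

end

section \<open>The embedding\<close>

theorem theorem13:
  fixes X :: "'a set" and \<delta> :: "'a set \<Rightarrow> real"
  assumes "finite X" and "submodular_diversity X \<delta>"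
  shows "sublinear_embeddable X \<delta>"
proof -
  interpret submodular_diversity X \<delta> by fact
  obtain es where es: "set es = X" "distinct es"
    using \<open>finite X\<close> finite_distinct_list by blast
  define n where "n = length es"
  define pos where "pos x = (THE j. j < n \<and> es ! j = x)" for x
  have pos: "pos x < n" "es ! pos x = x" if "x \<in> X" for x
    using theI'[OF distinct_Ex1[OF es(2)], of x] that es(1) by (auto simp: pos_def n_def)
  define \<phi> where "\<phi> x = (unit_vec n (pos x) :: real vec)" for x
  define u where "u xs i = vec n (\<lambda>j. profile \<delta> xs i {es ! j})" for xs i
  have u_\<phi>: "u xs i \<bullet> \<phi> x = profile \<delta> xs i {x}" if "x \<in> X" for xs i x
    using pos[OF that] by (simp add: u_def \<phi>_def scalar_prod_right_unit)
  have "\<exists>xs. set xs = X \<and> (\<exists>ys zs. ys @ zs = xs \<and> set ys = B)" if "B \<subseteq> X" for B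
  proof -
    have "finite B" "finite (X - B)"
      using that \<open>finite X\<close> finite_subset by auto
    then obtain ys zs where "set ys = B" "set zs = X - B"
      by (metis finite_list)
    then show ?thesis
      using that by (intro exI[of _ "ys @ zs"]) auto
  qed
  then obtain enum where enum: "\<And>B. B \<subseteq> X \<Longrightarrow> set (enum B) = X"
      "\<And>B. B \<subseteq> X \<Longrightarrow> \<exists>ys zs. ys @ zs = enum B \<and> set ys = B"
    by metis
  define D where "D B = sum_of_maxima {..<length (enum B)} (u (enum B))" for B
  define \<delta>' where "\<delta>' V = Max ((\<lambda>B. D B V) ` Pow X)" for V
  have "sublinear_diversity n (D B)" if "B \<subseteq> X" for B
    unfolding D_def
  proof (rule sublinear_diversity_sum_of_maxima)
    fix v :: "real vec" assume v: "v \<in> carrier_vec n"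
    have "(\<Sum>i<length (enum B). u (enum B) i \<bullet> v)
        = (\<Sum>j<n. (\<Sum>i<length (enum B). profile \<delta> (enum B) i {es ! j}) * v $ j)"
      using v unfolding u_def scalar_prod_def
      by (simp add: sum_distrib_right atLeast0LessThan sum.swap[of _ "{..<n}"])
    also have "\<dots> = 0"
    proof (intro sum.neutral ballI)
      fix j assume "j \<in> {..<n}"
      then have "es ! j \<in> X"
        using es n_def nth_mem by blast
      then show "(\<Sum>i<length (enum B). profile \<delta> (enum B) i {es ! j}) * v $ j = 0"
        using that trivial[of "{}"] trivial[of "{es ! j}"] by (simp add: sum_profile enum)
    qed
    finally show "(\<Sum>i<length (enum B). u (enum B) i \<bullet> v) = 0" .
  qed (simp add: u_def)
  then have sublin: "sublinear_diversity n \<delta>'"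
    unfolding \<delta>'_def using \<open>finite X\<close> by (intro sublinear_diversity_Max) auto
  have D_\<phi>: "D B (\<phi> ` A) = (\<Sum>i<length (enum B). Max ((\<lambda>x. profile \<delta> (enum B) i {x}) ` A))"
    if "A \<subseteq> X" "A \<noteq> {}" for A B
  proof -
    have "(\<lambda>v. u (enum B) i \<bullet> v) ` \<phi> ` A = (\<lambda>x. profile \<delta> (enum B) i {x}) ` A" for i
      unfolding image_image using that by (intro image_cong) (auto simp: u_\<phi>)
    then show ?thesis
      using that by (simp add: D_def sum_of_maxima_def)
  qed
  have "\<delta>' (\<phi> ` A) = \<delta> A" if "A \<subseteq> X" for A
  proof (cases "A = {}")
    case True
    moreover have "Pow X \<noteq> {}" by blast
    ultimately show ?thesis
      using trivial[of "{}"] by (simp add: \<delta>'_def D_def sum_of_maxima_def image_constant_conv)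
  next
    case False
    have le: "D B (\<phi> ` A) \<le> \<delta> A" if "B \<subseteq> X" for B
      using sum_Max_profile_le[of "enum B" A] enum(1)[OF that] \<open>A \<subseteq> X\<close> False by (simp add: D_\<phi>)
    obtain ys zs where "ys @ zs = enum A" "set ys = A"
      using enum(2)[OF \<open>A \<subseteq> X\<close>] by blast
    then have "\<delta> A \<le> D A (\<phi> ` A)"
      using sum_Max_profile_prefix_ge[of ys zs "enum A"] enum(1) \<open>A \<subseteq> X\<close> False
      by (auto simp: D_\<phi>)
    then have "\<delta> A = D A (\<phi> ` A)"
      using le \<open>A \<subseteq> X\<close> by (simp add: antisym)
    then have "\<delta> A \<in> (\<lambda>B. D B (\<phi> ` A)) ` Pow X"
      using \<open>A \<subseteq> X\<close> by blast
    then show ?thesis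
      unfolding \<delta>'_def using le \<open>finite X\<close> by (intro Max_eqI) auto
  qed
  moreover have "\<phi> ` X \<subseteq> carrier_vec n"
    by (auto simp: \<phi>_def)
  ultimately have "diversity_embedding \<phi> X \<delta> (carrier_vec n) \<delta>'"
    by (simp add: diversity_embedding_def)
  with sublin show ?thesis
    unfolding sublinear_embeddable_def by blast
qed

end
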